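(* Let $h:\mathbb{R}^n\to\mathbb{R}$ be differentiable with $L$-Lipschitz continuous gradient ($L>0$) and strongly quasiconvex with modulus $\gamma>0$, and let $\overline{x}$ be its unique minimizer on $\mathbb{R}^n$. Let $\eta>1$, $0<\beta<\frac{\gamma}{\eta L^2}$, and $$\mu_1:=\frac{1}{1+\beta(\gamma-\eta\beta L^2)}\in\,]0,1[,\qquad \mu_2:=\frac{1-\frac1\eta}{1+\beta(\gamma-\eta\beta L^2)}>0.$$ Let $\epsilon\in\left]0,\frac{1}{\mu_1}-1\right[$ and let $\alpha\in[0,1]$, $\theta\ge0$ satisfy $$\alpha+\theta L\ \le\ \frac{\mu_1\mu_2(1+\epsilon)}{\mu_1\mu_2(1+\epsilon)+\mu_1+\frac{\mu_1}{\epsilon}+\mu_2}.$$ Then the sequence $\{x_k\}_k$ generated by the Nesterov-type method with Hessian correction $$y_k=x_k+\alpha(x_k-x_{k-1})-\theta\left(\nabla h(x_k)-\nabla h(x_{k-1})\right),\qquad x_{k+1}=y_k-\beta\nabla h(y_k)\qquad(k\ge0)$$ from arbitrary starting points $x_{-1},x_0\in\mathbb{R}^n$ converges linearly to $\overline{x}$, and the sequence $\{h(x_k)\}_k$ converges linearly to the optimal value $h^*=h(\overline{x})$.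
   Context: $\|\cdot\|$ is the Euclidean norm on $\mathbb{R}^n$. A function $h:\mathbb{R}^n\to\mathbb{R}$ is strongly quasiconvex with modulus $\gamma>0$ if for all $x,y\in\mathbb{R}^n$ and $\lambda\in[0,1]$, $$h(\lambda y+(1-\lambda)x)\le\max\{h(y),h(x)\}-\lambda(1-\lambda)\frac{\gamma}{2}\|x-y\|^2.$$ It is known that a lower semicontinuous strongly quasiconvex function on $\mathbb{R}^n$ has exactly one minimizer. A sequence $\{z_k\}_k$ converges linearly to $z$ if there exist $C\ge0$ and $q\in\,]0,1[$ such that $\|z_k-z\|\le Cq^k$ for all $k\ge 0$. *)

theory Defs
  imports "HOL-Analysis.Analysis"
begin

definition strongly_quasiconvex :: "real \<Rightarrow> ('a::real_normed_vector \<Rightarrow> real) \<Rightarrow> bool" where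
  "strongly_quasiconvex \<gamma> h \<longleftrightarrow>
     (\<forall>x y. \<forall>t\<in>{0..1}.
        h (t *\<^sub>R y + (1 - t) *\<^sub>R x)
          \<le> max (h y) (h x) - t * (1 - t) * (\<gamma> / 2) * (norm (x - y))\<^sup>2)"

definition converges_linearly :: "(nat \<Rightarrow> 'a::real_normed_vector) \<Rightarrow> 'a \<Rightarrow> bool" where
  "converges_linearly z l \<longleftrightarrow>
     (\<exists>C\<ge>0. \<exists>q\<in>{0<..<1}. \<forall>k. norm (z k - l) \<le> C * q ^ k)"

text \<open>
  The sequences are indexed by integers because the method starts from two points
  \<open>x (-1)\<close> and \<open>x 0\<close>. The values of \<open>x\<close> below \<open>-1\<close> and of \<open>y\<close> below \<open>0\<close> are irrelevant.
  The argument \<open>g\<close> stands for the gradient of the objective function.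
\<close>

definition nesterov_hessian_iteration ::
  "('a::real_normed_vector \<Rightarrow> 'a) \<Rightarrow> real \<Rightarrow> real \<Rightarrow> real \<Rightarrow> (int \<Rightarrow> 'a) \<Rightarrow> (int \<Rightarrow> 'a) \<Rightarrow> bool" where
  "nesterov_hessian_iteration g \<alpha> \<theta> \<beta> x y \<longleftrightarrow>
     (\<forall>k\<ge>0. y k = x k + \<alpha> *\<^sub>R (x k - x (k - 1)) - \<theta> *\<^sub>R (g (x k) - g (x (k - 1)))
            \<and> x (k + 1) = y k - \<beta> *\<^sub>R g (y k))"

end

theory Submission
  imports Defs
begin

text \<open>
  Differentiating the defining inequality of strong quasiconvexity along the segment from a
  point to the minimizer gives
  \<open>\<gamma> / 2 * (norm (u - xbar))\<^sup>2 \<le> inner (grad u) (u - xbar)\<close>, which replaces strong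
  monotonicity of the gradient.  The idea is to use this inequality at the new iterate
  \<open>u = x (k + 1)\<close> and not at \<open>y k\<close>, as if the gradient step were an implicit (proximal) step;
  the error \<open>grad (y k) - grad (x (k + 1))\<close> that this makes is controlled by the
  Lipschitz constant and Young's inequality with weight \<open>\<eta>\<close>.  Dividing the outcome (lemma
  \<open>gradient_step_contraction\<close>) by \<open>1 + \<beta> * (\<gamma> - \<eta> * \<beta> * L\<^sup>2)\<close> gives
  \<open>(norm (x (k + 1) - xbar))\<^sup>2 \<le> \<mu>\<^sub>1 * (norm (y k - xbar))\<^sup>2 - \<mu>\<^sub>2 * (norm (x (k + 1) - y k))\<^sup>2\<close>,
  whose negative last term pays for the extrapolation.

  Both the momentum and the Hessian correction are bounded by the last displacement:
  \<open>norm (y k - x k) \<le> \<kappa> * norm (x k - x (k - 1))\<close> with \<open>\<kappa> = \<alpha> + \<theta> * L\<close>.  The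
  method is therefore a gradient step from a point near \<open>x k\<close>, and the energy
  \<open>(norm (x k - xbar))\<^sup>2 + \<mu>\<^sub>2 * (1 - \<kappa>) * (norm (x k - x (k - 1)))\<^sup>2\<close>
  shrinks at least by the factor \<open>\<mu>\<^sub>1 * (1 + \<epsilon>) < 1\<close> at each step
  (lemma \<open>inertial_energy_decrease\<close>); the bound assumed on \<open>\<kappa>\<close> is what makes the displacement part of the energy shrink at
  the same rate.  Linear convergence of the iterates is immediate, and that of the values follows
  because the gradient vanishes at \<open>xbar\<close>, so that \<open>h\<close> grows at most quadratically there.
\<close>

section \<open>First-order consequences of strong quasiconvexity and smoothness\<close>

lemma GDERIV_along_segment:
  fixes h :: "'a::real_inner \<Rightarrow> real"
  assumes "\<And>u. GDERIV h u :> g u"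
  shows "((\<lambda>t. h (a + t *\<^sub>R v)) has_real_derivative inner v (g (a + t *\<^sub>R v))) (at t)"
proof -
  have h: "(h has_derivative (\<lambda>w. inner w (g (a + t *\<^sub>R v)))) (at (a + t *\<^sub>R v))"
    using assms by (simp add: gderiv_def)
  have line: "((\<lambda>t. a + t *\<^sub>R v) has_derivative (\<lambda>s. s *\<^sub>R v)) (at t)"
    by (auto intro!: derivative_eq_intros)
  have "((\<lambda>t. h (a + t *\<^sub>R v)) has_derivative (\<lambda>s. inner (s *\<^sub>R v) (g (a + t *\<^sub>R v)))) (at t)"
    using has_derivative_compose[OF line h] .
  then show ?thesis
    by (simp add: has_field_derivative_def mult.commute[of _ "inner v _"])
qed

text \<open>
  The first-order form of strong quasiconvexity: divide the defining inequality on the segment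
  from \<open>a\<close> to \<open>b\<close> by the parameter \<open>t\<close> and let \<open>t\<close> tend to \<open>0\<close>.
\<close>

lemma strongly_quasiconvex_gradient:
  fixes h :: "'a::real_inner \<Rightarrow> real"
  assumes deriv: "\<And>u. GDERIV h u :> g u"
    and qc: "strongly_quasiconvex \<gamma> h"
    and le: "h b \<le> h a"
  shows "\<gamma> / 2 * (norm (a - b))\<^sup>2 \<le> inner (g a) (a - b)"
proof -
  define \<phi> where "\<phi> t = h (a + t *\<^sub>R (b - a))" for t
  let ?c = "\<gamma> / 2 * (norm (a - b))\<^sup>2"
  have "(\<phi> has_real_derivative inner (b - a) (g a)) (at 0)"
    using GDERIV_along_segment[OF deriv, of a "b - a" 0] by (simp add: \<phi>_def[abs_def])
  then have "((\<lambda>t. (\<phi> t - \<phi> 0) / t) \<longlongrightarrow> inner (b - a) (g a)) (at 0)"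
    by (simp add: DERIV_def)
  then have quot: "((\<lambda>t. (\<phi> t - \<phi> 0) / t) \<longlongrightarrow> inner (b - a) (g a)) (at_right 0)"
    by (rule filterlim_mono) (auto simp: at_le)
  have bound: "((\<lambda>t. - (1 - t) * ?c) \<longlongrightarrow> - ?c) (at_right 0)"
    by (auto intro!: tendsto_eq_intros)
  have below: "(\<phi> t - \<phi> 0) / t \<le> - (1 - t) * ?c" if "0 < t" "t < 1" for t
  proof -
    have "h (t *\<^sub>R b + (1 - t) *\<^sub>R a)
        \<le> max (h b) (h a) - t * (1 - t) * (\<gamma> / 2) * (norm (a - b))\<^sup>2"
      using qc that unfolding strongly_quasiconvex_def by auto
    moreover have "t *\<^sub>R b + (1 - t) *\<^sub>R a = a + t *\<^sub>R (b - a)"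
      by (simp add: algebra_simps)
    ultimately have "\<phi> t - \<phi> 0 \<le> - (1 - t) * ?c * t"
      using le by (simp add: \<phi>_def max_absorb2 field_simps)
    then show ?thesis
      using that by (simp add: pos_divide_le_eq)
  qed
  have "\<forall>\<^sub>F t in at_right (0::real). 0 < t \<and> t < 1"
    using eventually_at_right_real[of 0 1] by simp
  then have "\<forall>\<^sub>F t in at_right 0. (\<phi> t - \<phi> 0) / t \<le> - (1 - t) * ?c"
    by eventually_elim (use below in auto)
  then have "inner (b - a) (g a) \<le> - ?c"
    using tendsto_le[OF _ bound quot] by simp
  then show ?thesis
    by (simp add: inner_diff_left inner_diff_right inner_commute)
qed

lemma gradient_at_minimizer:
  fixes h :: "'a::real_inner \<Rightarrow> real"
  assumes "GDERIV h a :> d" and "\<And>u. h a \<le> h u"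
  shows "d = 0"
proof -
  have "(\<lambda>v. inner v d) = (\<lambda>v. 0)"
    using differential_zero_maxmin[of a UNIV h "\<lambda>v. inner v d"] assms
    by (simp add: gderiv_def)
  then have "inner d d = 0" by metis
  then show ?thesis by simp
qed

text \<open>
  By the mean value theorem the increment of \<open>h\<close> is a directional derivative at a point between
  \<open>a\<close> and \<open>u\<close>, where the gradient is at most \<open>L * norm (u - a)\<close> because it vanishes at \<open>a\<close>.
  The sharp constant \<open>L / 2\<close> would not improve a convergence rate.
\<close>

lemma lipschitz_gradient_quadratic_bound:
  fixes h :: "'a::real_inner \<Rightarrow> real"
  assumes deriv: "\<And>u. GDERIV h u :> g u"
    and lip: "L-lipschitz_on UNIV g" and "g a = 0"
  shows "h u - h a \<le> L * (norm (u - a))\<^sup>2"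
proof -
  obtain t where t: "0 < t" "t < 1"
    and eq: "h u - h a = inner (u - a) (g (a + t *\<^sub>R (u - a)))"
    using MVT2[of 0 1 "\<lambda>t. h (a + t *\<^sub>R (u - a))"
        "\<lambda>t. inner (u - a) (g (a + t *\<^sub>R (u - a)))"]
      GDERIV_along_segment[OF deriv] by auto
  have "norm (g (a + t *\<^sub>R (u - a))) \<le> L * norm (t *\<^sub>R (u - a))"
    using lipschitz_onD[OF lip, of "a + t *\<^sub>R (u - a)" a] \<open>g a = 0\<close> by (simp add: dist_norm)
  also have "\<dots> \<le> L * norm (u - a)"
    using t lipschitz_on_nonneg[OF lip] by (auto intro!: mult_left_mono mult_left_le_one_le)
  finally have "norm (u - a) * norm (g (a + t *\<^sub>R (u - a))) \<le> norm (u - a) * (L * norm (u - a))"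
    by (rule mult_left_mono) simp
  with norm_cauchy_schwarz[of "u - a" "g (a + t *\<^sub>R (u - a))"] eq show ?thesis
    by (simp add: power2_eq_square mult.left_commute)
qed

section \<open>The gradient step and the energy\<close>

text \<open>
  Expanding \<open>v - a\<close> around the new point \<open>u\<close> leaves the cross term \<open>2 * \<beta> * inner (g v) (u - a)\<close>.
  Its part with \<open>g u\<close> is, by the first hypothesis, at least the gain \<open>\<beta> * \<gamma> * (norm (u - a))\<^sup>2\<close>;
  the rest is at most
  \<open>2 * \<beta> * L * norm (v - u) * norm (u - a)\<close> in size, and \<open>\<eta>\<close> decides how Young's inequality
  divides it between the two squares.
\<close>

lemma gradient_step_contraction:
  fixes g :: "'a::real_inner \<Rightarrow> 'a"
  assumes mono: "\<gamma> / 2 * (norm (u - a))\<^sup>2 \<le> inner (g u) (u - a)"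
    and lip: "L-lipschitz_on UNIV g"
    and "0 < \<eta>" and "0 \<le> \<beta>"
    and u: "u = v - \<beta> *\<^sub>R g v"
  shows "(1 + \<beta> * (\<gamma> - \<eta> * \<beta> * L\<^sup>2)) * (norm (u - a))\<^sup>2
    \<le> (norm (v - a))\<^sup>2 - (1 - 1 / \<eta>) * (norm (u - v))\<^sup>2"
proof -
  let ?p = "norm (u - a)" and ?r = "norm (u - v)"
  have step: "v - u = \<beta> *\<^sub>R g v" using u by simp
  have "(norm (v - a))\<^sup>2 = (norm ((v - u) + (u - a)))\<^sup>2" by simp
  also have "\<dots> = ?r\<^sup>2 + ?p\<^sup>2 + 2 * inner (v - u) (u - a)"
    by (simp only: power2_norm_eq_inner inner_add_left inner_add_right norm_minus_commute[of u v])
       (simp add: inner_commute)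
  finally have expand: "(norm (v - a))\<^sup>2 = ?r\<^sup>2 + ?p\<^sup>2 + 2 * \<beta> * inner (g v) (u - a)"
    by (simp add: step)
  have "\<bar>inner (g v - g u) (u - a)\<bar> \<le> norm (g v - g u) * ?p"
    by (rule Cauchy_Schwarz_ineq2)
  also have "\<dots> \<le> L * ?r * ?p"
    using lipschitz_onD[OF lip, of v u]
    by (intro mult_right_mono) (auto simp: dist_norm norm_minus_commute)
  finally have "inner (g u) (u - a) - L * ?r * ?p \<le> inner (g v) (u - a)"
    by (simp add: inner_diff_left)
  with mono have "\<gamma> / 2 * ?p\<^sup>2 - L * ?r * ?p \<le> inner (g v) (u - a)" by linarith
  from mult_left_mono[OF this, of "2 * \<beta>"] \<open>0 \<le> \<beta>\<close>
  have cross: "\<beta> * \<gamma> * ?p\<^sup>2 - 2 * (\<beta> * L * ?r * ?p) \<le> 2 * \<beta> * inner (g v) (u - a)"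
    by (simp add: algebra_simps)
  have "0 \<le> \<eta> * (?r / \<eta> - \<beta> * L * ?p)\<^sup>2" using \<open>0 < \<eta>\<close> by simp
  also have "\<dots> = ?r\<^sup>2 / \<eta> - 2 * (\<beta> * L * ?r * ?p) + \<eta> * \<beta>\<^sup>2 * L\<^sup>2 * ?p\<^sup>2"
    using \<open>0 < \<eta>\<close> by (simp add: power2_eq_square field_simps)
  finally show ?thesis
    using expand cross by (simp add: algebra_simps power2_eq_square)
qed

lemma young_norm_add:
  fixes p q :: "'a::real_inner"
  assumes "0 < \<epsilon>"
  shows "(norm (p + q))\<^sup>2 \<le> (1 + \<epsilon>) * (norm p)\<^sup>2 + (1 + 1 / \<epsilon>) * (norm q)\<^sup>2"
proof -
  have "(norm (p + q))\<^sup>2 \<le> (norm p + norm q)\<^sup>2"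
    by (simp add: norm_triangle_ineq power_mono)
  moreover have "0 \<le> \<epsilon> * (norm p - norm q / \<epsilon>)\<^sup>2" using assms by simp
  moreover have "\<epsilon> * (norm p - norm q / \<epsilon>)\<^sup>2 = \<epsilon> * (norm p)\<^sup>2 - 2 * norm p * norm q + (norm q)\<^sup>2 / \<epsilon>"
    using assms by (simp add: power2_eq_square field_simps)
  ultimately show ?thesis by (simp add: power2_sum algebra_simps)
qed

text \<open>
  Young's inequality with weight \<open>\<kappa>\<close>, with the loss stated through \<open>s\<close> rather than as a
  multiple of \<open>(norm e)\<^sup>2 / \<kappa>\<close>, so that the case \<open>\<kappa> = 0\<close> of no extrapolation is covered.
\<close>

lemma norm_diff_lower_bound:
  fixes d e :: "'a::real_inner"
  assumes "0 \<le> \<kappa>" "\<kappa> \<le> 1" "0 \<le> s" "norm e \<le> \<kappa> * s"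
  shows "(1 - \<kappa>) * (norm d)\<^sup>2 - \<kappa> * (1 - \<kappa>) * s\<^sup>2 \<le> (norm (d - e))\<^sup>2"
proof -
  have "(1 - \<kappa>) * (norm d)\<^sup>2 - \<kappa> * (1 - \<kappa>) * s\<^sup>2 \<le> (norm d - norm e)\<^sup>2"
  proof (cases "\<kappa> = 0")
    case True
    with assms show ?thesis by simp
  next
    case False
    with assms have "0 < \<kappa>" by simp
    have "(norm e)\<^sup>2 \<le> (\<kappa> * s)\<^sup>2" using assms by (simp add: power_mono)
    then have "(1 - \<kappa>) * (norm e)\<^sup>2 / \<kappa> \<le> (1 - \<kappa>) * (\<kappa> * s)\<^sup>2 / \<kappa>"
      using assms \<open>0 < \<kappa>\<close> by (intro divide_right_mono mult_left_mono) auto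
    also have "\<dots> = \<kappa> * (1 - \<kappa>) * s\<^sup>2"
      using \<open>0 < \<kappa>\<close> by (simp add: power2_eq_square)
    finally have e: "(1 - \<kappa>) * (norm e)\<^sup>2 / \<kappa> \<le> \<kappa> * (1 - \<kappa>) * s\<^sup>2" .
    have "0 \<le> \<kappa> * (norm d - norm e / \<kappa>)\<^sup>2" using \<open>0 < \<kappa>\<close> by simp
    also have "\<dots> = (norm d - norm e)\<^sup>2 - (1 - \<kappa>) * (norm d)\<^sup>2 + (1 - \<kappa>) * (norm e)\<^sup>2 / \<kappa>"
      using \<open>0 < \<kappa>\<close> by (simp add: power2_eq_square field_simps)
    finally show ?thesis using e by linarith
  qed
  also have "\<dots> \<le> (norm (d - e))\<^sup>2"
    using norm_triangle_ineq3[of d e] by (simp add: abs_le_square_iff[symmetric])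
  finally show ?thesis .
qed

text \<open>
  Here \<open>w\<close>, \<open>x\<close>, \<open>u\<close> are consecutive iterates and \<open>v\<close> is the extrapolated point.  Splitting
  \<open>v - a\<close> at \<open>x\<close> by Young's inequality and bounding \<open>norm (u - v)\<close> below by the displacement
  \<open>norm (u - x)\<close> produces the energy of the new pair.  The displacement \<open>norm (x - w)\<close> then
  occurs with the coefficient \<open>\<mu>\<^sub>1 * (1 + 1 / \<epsilon>) * \<kappa>\<^sup>2 + \<mu>\<^sub>2 * \<kappa> * (1 - \<kappa>)\<close>, and
  this has to be at most \<open>\<mu>\<^sub>1 * (1 + \<epsilon>) * \<mu>\<^sub>2 * (1 - \<kappa>)\<close>.  Replacing \<open>\<kappa>\<^sup>2\<close> by
  \<open>\<kappa>\<close> in the first summand and \<open>1 - \<kappa>\<close> by \<open>1\<close> in the second makes the requirement linear in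
  \<open>\<kappa>\<close>, and it is then the assumed bound.
\<close>

lemma inertial_energy_decrease:
  fixes a u v w x :: "'a::real_inner"
  assumes contr: "(norm (u - a))\<^sup>2 \<le> \<mu>\<^sub>1 * (norm (v - a))\<^sup>2 - \<mu>\<^sub>2 * (norm (u - v))\<^sup>2"
    and extra: "norm (v - x) \<le> \<kappa> * norm (x - w)"
    and "0 < \<mu>\<^sub>1" "0 < \<mu>\<^sub>2" "0 < \<epsilon>" "0 \<le> \<kappa>" "\<kappa> \<le> 1"
    and \<kappa>: "\<kappa> * (\<mu>\<^sub>1 * \<mu>\<^sub>2 * (1 + \<epsilon>) + \<mu>\<^sub>1 + \<mu>\<^sub>1 / \<epsilon> + \<mu>\<^sub>2) \<le> \<mu>\<^sub>1 * \<mu>\<^sub>2 * (1 + \<epsilon>)"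
  shows "(norm (u - a))\<^sup>2 + \<mu>\<^sub>2 * (1 - \<kappa>) * (norm (u - x))\<^sup>2
    \<le> \<mu>\<^sub>1 * (1 + \<epsilon>) * ((norm (x - a))\<^sup>2 + \<mu>\<^sub>2 * (1 - \<kappa>) * (norm (x - w))\<^sup>2)"
proof -
  let ?b = "(norm (x - w))\<^sup>2"
  have "(norm (v - x))\<^sup>2 \<le> (\<kappa> * norm (x - w))\<^sup>2"
    using extra by (intro power_mono) auto
  then have "(1 + 1 / \<epsilon>) * (norm (v - x))\<^sup>2 \<le> (1 + 1 / \<epsilon>) * (\<kappa>\<^sup>2 * ?b)"
    using \<open>0 < \<epsilon>\<close> by (intro mult_left_mono) (auto simp: power_mult_distrib)
  with young_norm_add[OF \<open>0 < \<epsilon>\<close>, of "x - a" "v - x"]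
  have "(norm (v - a))\<^sup>2 \<le> (1 + \<epsilon>) * (norm (x - a))\<^sup>2 + (1 + 1 / \<epsilon>) * (\<kappa>\<^sup>2 * ?b)" by simp
  from mult_left_mono[OF this, of \<mu>\<^sub>1] \<open>0 < \<mu>\<^sub>1\<close>
  have va: "\<mu>\<^sub>1 * (norm (v - a))\<^sup>2
      \<le> \<mu>\<^sub>1 * (1 + \<epsilon>) * (norm (x - a))\<^sup>2 + \<mu>\<^sub>1 * (1 + 1 / \<epsilon>) * \<kappa>\<^sup>2 * ?b"
    by (simp add: algebra_simps)
  have "(1 - \<kappa>) * (norm (u - x))\<^sup>2 - \<kappa> * (1 - \<kappa>) * ?b \<le> (norm (u - v))\<^sup>2"
    using norm_diff_lower_bound[OF \<open>0 \<le> \<kappa>\<close> \<open>\<kappa> \<le> 1\<close> _ extra, of "u - x"] by simp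
  from mult_left_mono[OF this, of \<mu>\<^sub>2] \<open>0 < \<mu>\<^sub>2\<close>
  have uv: "\<mu>\<^sub>2 * (1 - \<kappa>) * (norm (u - x))\<^sup>2 - \<mu>\<^sub>2 * \<kappa> * (1 - \<kappa>) * ?b
      \<le> \<mu>\<^sub>2 * (norm (u - v))\<^sup>2"
    by (simp add: algebra_simps)
  have "\<kappa>\<^sup>2 \<le> \<kappa>"
    using \<open>0 \<le> \<kappa>\<close> \<open>\<kappa> \<le> 1\<close> by (simp add: power2_eq_square mult_left_le)
  then have "\<mu>\<^sub>1 * (1 + 1 / \<epsilon>) * \<kappa>\<^sup>2 \<le> \<mu>\<^sub>1 * (1 + 1 / \<epsilon>) * \<kappa>"
    using \<open>0 < \<mu>\<^sub>1\<close> \<open>0 < \<epsilon>\<close> by (intro mult_left_mono) auto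
  moreover have "0 \<le> \<mu>\<^sub>2 * \<kappa>\<^sup>2" using \<open>0 < \<mu>\<^sub>2\<close> by simp
  ultimately have "\<mu>\<^sub>1 * (1 + 1 / \<epsilon>) * \<kappa>\<^sup>2 + \<mu>\<^sub>2 * \<kappa> * (1 - \<kappa>)
      \<le> \<mu>\<^sub>1 * (1 + \<epsilon>) * (\<mu>\<^sub>2 * (1 - \<kappa>))"
    using \<kappa> by (simp add: algebra_simps power2_eq_square)
  from mult_right_mono[OF this, of ?b]
  have "\<mu>\<^sub>1 * (1 + 1 / \<epsilon>) * \<kappa>\<^sup>2 * ?b + \<mu>\<^sub>2 * \<kappa> * (1 - \<kappa>) * ?b
      \<le> \<mu>\<^sub>1 * (1 + \<epsilon>) * (\<mu>\<^sub>2 * (1 - \<kappa>) * ?b)"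
    by (simp add: distrib_right mult.assoc)
  with contr va uv show ?thesis
    unfolding distrib_left[of "\<mu>\<^sub>1 * (1 + \<epsilon>)"] by linarith
qed

section \<open>Linear convergence of the method\<close>

lemma geometric_decay:
  fixes E :: "nat \<Rightarrow> real"
  assumes "0 \<le> q" and "\<And>k. E (Suc k) \<le> q * E k"
  shows "E k \<le> E 0 * q ^ k"
proof (induction k)
  case (Suc k)
  have "E (Suc k) \<le> q * E k" by (rule assms(2))
  also have "\<dots> \<le> q * (E 0 * q ^ k)" using Suc \<open>0 \<le> q\<close> by (rule mult_left_mono)
  finally show ?case by (simp add: mult.left_commute)
qed simp

lemma converges_linearly_of_square:
  assumes q: "q \<in> {0<..<1}"
    and bound: "\<And>k. (norm (z k - l))\<^sup>2 \<le> C * q ^ k"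
  shows "converges_linearly z l"
proof -
  have "norm (z k - l) \<le> sqrt C * sqrt q ^ k" for k
    using real_le_rsqrt[OF bound[of k]] by (simp add: real_sqrt_mult real_sqrt_power)
  moreover have "0 \<le> sqrt C"
    using order_trans[OF zero_le_power2 bound[of 0]] by simp
  moreover have "sqrt q \<in> {0<..<1}" using q by simp
  ultimately show ?thesis unfolding converges_linearly_def by blast
qed

lemma extrapolation_bound:
  fixes g :: "'a::real_normed_vector \<Rightarrow> 'a"
  assumes "L-lipschitz_on UNIV g" and "0 \<le> \<alpha>" and "0 \<le> \<theta>"
    and v: "v = x + \<alpha> *\<^sub>R (x - w) - \<theta> *\<^sub>R (g x - g w)"
  shows "norm (v - x) \<le> (\<alpha> + \<theta> * L) * norm (x - w)"
proof -
  have "norm (v - x) \<le> \<alpha> * norm (x - w) + \<theta> * norm (g x - g w)"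
    using norm_triangle_ineq4[of "\<alpha> *\<^sub>R (x - w)" "\<theta> *\<^sub>R (g x - g w)"] assms by simp
  also have "\<theta> * norm (g x - g w) \<le> \<theta> * (L * norm (x - w))"
    using lipschitz_onD[OF assms(1), of x w] \<open>0 \<le> \<theta>\<close>
    by (intro mult_left_mono) (auto simp: dist_norm)
  finally show ?thesis by (simp add: algebra_simps)
qed

theorem theorem17:
  fixes h :: "real ^ 'n \<Rightarrow> real" and grad :: "real ^ 'n \<Rightarrow> real ^ 'n"
    and xbar :: "real ^ 'n" and L \<gamma> \<eta> \<beta> \<mu>\<^sub>1 \<mu>\<^sub>2 :: real
  assumes gradient: "\<And>x. GDERIV h x :> grad x"
    and "0 < L" and lipschitz: "L-lipschitz_on UNIV grad"
    and "0 < \<gamma>" and quasiconvex: "strongly_quasiconvex \<gamma> h"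
    and minimizer: "is_arg_min h (\<lambda>_. True) xbar"
    and "1 < \<eta>" and "0 < \<beta>" and "\<beta> < \<gamma> / (\<eta> * L\<^sup>2)"
    and \<mu>1: "\<mu>\<^sub>1 = 1 / (1 + \<beta> * (\<gamma> - \<eta> * \<beta> * L\<^sup>2))"
    and \<mu>2: "\<mu>\<^sub>2 = (1 - 1 / \<eta>) / (1 + \<beta> * (\<gamma> - \<eta> * \<beta> * L\<^sup>2))"
  shows "\<mu>\<^sub>1 \<in> {0<..<1} \<and> \<mu>\<^sub>2 > 0 \<and>
    (\<forall>\<epsilon> \<alpha> \<theta> x y.
       \<epsilon> \<in> {0<..<1 / \<mu>\<^sub>1 - 1} \<longrightarrow> \<alpha> \<in> {0..1} \<longrightarrow> 0 \<le> \<theta> \<longrightarrow>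
       \<alpha> + \<theta> * L \<le> \<mu>\<^sub>1 * \<mu>\<^sub>2 * (1 + \<epsilon>) / (\<mu>\<^sub>1 * \<mu>\<^sub>2 * (1 + \<epsilon>) + \<mu>\<^sub>1 + \<mu>\<^sub>1 / \<epsilon> + \<mu>\<^sub>2) \<longrightarrow>
       nesterov_hessian_iteration grad \<alpha> \<theta> \<beta> x y \<longrightarrow>
         converges_linearly (\<lambda>k. x (int k)) xbar \<and>
         converges_linearly (\<lambda>k. h (x (int k))) (h xbar))"
proof -
  define D where "D = 1 + \<beta> * (\<gamma> - \<eta> * \<beta> * L\<^sup>2)"
  have "\<beta> * (\<eta> * L\<^sup>2) < \<gamma>"
    using \<open>\<beta> < \<gamma> / (\<eta> * L\<^sup>2)\<close> \<open>1 < \<eta>\<close> \<open>0 < L\<close> by (simp add: pos_less_divide_eq)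
  then have D: "1 < D"
    using \<open>0 < \<beta>\<close> by (simp add: D_def mult.commute mult.left_commute)
  have \<mu>1_D: "\<mu>\<^sub>1 = 1 / D" and \<mu>2_D: "\<mu>\<^sub>2 = (1 - 1 / \<eta>) / D"
    using \<mu>1 \<mu>2 by (simp_all add: D_def)
  have \<mu>1_range: "\<mu>\<^sub>1 \<in> {0<..<1}" and \<mu>2_pos: "0 < \<mu>\<^sub>2"
    using D \<open>1 < \<eta>\<close> by (simp_all add: \<mu>1_D \<mu>2_D)
  have min: "h xbar \<le> h u" for u
    using minimizer by (simp add: is_arg_min_def not_less)
  have contraction: "(norm (u - xbar))\<^sup>2
      \<le> \<mu>\<^sub>1 * (norm (v - xbar))\<^sup>2 - \<mu>\<^sub>2 * (norm (u - v))\<^sup>2"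
    if "u = v - \<beta> *\<^sub>R grad v" for u v
  proof -
    have "D * (norm (u - xbar))\<^sup>2 \<le> (norm (v - xbar))\<^sup>2 - (1 - 1 / \<eta>) * (norm (u - v))\<^sup>2"
      unfolding D_def
      using gradient_step_contraction[OF strongly_quasiconvex_gradient[OF gradient quasiconvex min]
          lipschitz _ _ that] \<open>1 < \<eta>\<close> \<open>0 < \<beta>\<close> by simp
    then have "(norm (u - xbar))\<^sup>2
        \<le> ((norm (v - xbar))\<^sup>2 - (1 - 1 / \<eta>) * (norm (u - v))\<^sup>2) / D"
      using D by (simp add: pos_le_divide_eq mult.commute)
    then show ?thesis
      by (simp add: \<mu>1_D \<mu>2_D diff_divide_distrib left_diff_distrib)
  qed
  have "converges_linearly (\<lambda>k. x (int k)) xbar \<and>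
      converges_linearly (\<lambda>k. h (x (int k))) (h xbar)"
    if \<epsilon>: "\<epsilon> \<in> {0<..<1 / \<mu>\<^sub>1 - 1}" and \<alpha>: "\<alpha> \<in> {0..1}" and \<theta>: "0 \<le> \<theta>"
      and bound: "\<alpha> + \<theta> * L
        \<le> \<mu>\<^sub>1 * \<mu>\<^sub>2 * (1 + \<epsilon>) / (\<mu>\<^sub>1 * \<mu>\<^sub>2 * (1 + \<epsilon>) + \<mu>\<^sub>1 + \<mu>\<^sub>1 / \<epsilon> + \<mu>\<^sub>2)"
      and iter: "nesterov_hessian_iteration grad \<alpha> \<theta> \<beta> x y"
    for \<epsilon> \<alpha> \<theta> x y
  proof -
    define \<kappa> where "\<kappa> = \<alpha> + \<theta> * L"
    define q where "q = \<mu>\<^sub>1 * (1 + \<epsilon>)"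
    let ?N = "\<mu>\<^sub>1 * \<mu>\<^sub>2 * (1 + \<epsilon>)" and ?M = "\<mu>\<^sub>1 + \<mu>\<^sub>1 / \<epsilon> + \<mu>\<^sub>2"
    have pos: "0 < ?N" "0 < ?M" using \<mu>1_range \<mu>2_pos \<epsilon> by (auto intro!: add_pos_pos)
    have \<kappa>_bound: "\<kappa> \<le> ?N / (?N + ?M)" using bound by (simp add: \<kappa>_def add.assoc)
    have \<kappa>_nonneg: "0 \<le> \<kappa>" using \<alpha> \<theta> \<open>0 < L\<close> by (simp add: \<kappa>_def)
    have "?N / (?N + ?M) \<le> 1" using pos by simp
    with \<kappa>_bound have \<kappa>_le: "\<kappa> \<le> 1" by linarith
    have \<kappa>_mult: "\<kappa> * (?N + \<mu>\<^sub>1 + \<mu>\<^sub>1 / \<epsilon> + \<mu>\<^sub>2) \<le> ?N"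
      using \<kappa>_bound pos by (simp add: pos_le_divide_eq add.assoc)
    have q: "q \<in> {0<..<1}"
      using \<epsilon> \<mu>1_range by (simp add: q_def less_diff_eq pos_less_divide_eq mult.commute add.commute)
    define E where "E k = (norm (x (int k) - xbar))\<^sup>2
      + \<mu>\<^sub>2 * (1 - \<kappa>) * (norm (x (int k) - x (int k - 1)))\<^sup>2" for k
    have "E (Suc k) \<le> q * E k" for k
    proof -
      have y: "y (int k) = x (int k) + \<alpha> *\<^sub>R (x (int k) - x (int k - 1))
          - \<theta> *\<^sub>R (grad (x (int k)) - grad (x (int k - 1)))"
        and next_x: "x (int (Suc k)) = y (int k) - \<beta> *\<^sub>R grad (y (int k))"
        using iter by (simp_all add: nesterov_hessian_iteration_def add.commute[of 1])
      have "norm (y (int k) - x (int k)) \<le> \<kappa> * norm (x (int k) - x (int k - 1))"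
        using extrapolation_bound[OF lipschitz _ \<theta> y] \<alpha> by (simp add: \<kappa>_def)
      from inertial_energy_decrease[OF contraction[OF next_x] this _ \<mu>2_pos _ \<kappa>_nonneg \<kappa>_le \<kappa>_mult]
      show ?thesis using \<mu>1_range \<epsilon> by (simp add: E_def q_def)
    qed
    then have decay: "E k \<le> E 0 * q ^ k" for k
      using q by (intro geometric_decay) auto
    have "(norm (x (int k) - xbar))\<^sup>2 \<le> E k" for k
      using \<mu>2_pos \<kappa>_le by (simp add: E_def)
    then have sq: "(norm (x (int k) - xbar))\<^sup>2 \<le> E 0 * q ^ k" for k
      using decay order_trans by blast
    have "norm (h (x (int k)) - h xbar) \<le> L * E 0 * q ^ k" for k
    proof -
      have "norm (h (x (int k)) - h xbar) \<le> L * (norm (x (int k) - xbar))\<^sup>2"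
        using lipschitz_gradient_quadratic_bound[OF gradient lipschitz
            gradient_at_minimizer[OF gradient min]] min by simp
      also have "\<dots> \<le> L * (E 0 * q ^ k)"
        using sq \<open>0 < L\<close> by (intro mult_left_mono) auto
      finally show ?thesis by (simp add: mult.assoc)
    qed
    moreover have "0 \<le> L * E 0" using \<open>0 < L\<close> \<mu>2_pos \<kappa>_le by (simp add: E_def)
    ultimately have "converges_linearly (\<lambda>k. h (x (int k))) (h xbar)"
      using q unfolding converges_linearly_def by blast
    then show ?thesis using converges_linearly_of_square[OF q sq] by blast
  qed
  then show ?thesis using \<mu>1_range \<mu>2_pos by blast
qed

end
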